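(* There is a deterministic algorithm which, given any two mixtures of Boolean subcubes $\mathbb P=\sum_{s=1}^{k_1}\alpha^{(s)}\bigotimes_{i=1}^n\mathbb P^{(s)}_i$ (with $k_1$ components) and $\mathbb Q=\sum_{t=1}^{k_2}\beta^{(t)}\bigotimes_{i=1}^n\mathbb Q^{(t)}_i$ (with $k_2$ components) over $\{0,1\}^n$, computes the exact value of $d_{TV}(\mathbb P,\mathbb Q)$ in time $O((k_1+k_2)3^{k_1+k_2}\cdot n)$.
   Context: A mixture of product distributions over $\{0,1\}^n$ with $k$ components is $\mathbb P(\omega)=\sum_{s=1}^k\alpha^{(s)}\prod_{i=1}^n\mathbb P^{(s)}_i(\omega_i)$ with $\alpha^{(s)}\ge0$, $\sum_s\alpha^{(s)}=1$, each $\mathbb P^{(s)}_i$ a distribution on $\{0,1\}$. It is a mixture of Boolean subcubes if $\mathbb P^{(s)}_i(1)\in\{0,\tfrac12,1\}$ for all $s,i$. The input consists of the mixing weights and all marginals. $d_{TV}(\mathbb P,\mathbb Q)=\frac12\sum_{\omega}|\mathbb P(\omega)-\mathbb Q(\omega)|$. *)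

theory Defs
  imports "HOL-Probability.Probability_Mass_Function"
begin

section \<open>Mixtures of Boolean subcubes\<close>

text \<open>
  Components are numbered \<open>0, \<dots>, ncomp - 1\<close> and coordinates \<open>0, \<dots>, n - 1\<close>; values of
  \<open>weight\<close> and \<open>marginal\<close> outside these ranges are irrelevant. The alphabet \<open>{0, 1}\<close> is
  \<^typ>\<open>bool\<close>, with \<open>True\<close> for 1.
\<close>

record mixture =
  ncomp :: nat
  weight :: "nat \<Rightarrow> real"
  marginal :: "nat \<Rightarrow> nat \<Rightarrow> bool pmf"

definition cube :: "nat \<Rightarrow> (nat \<Rightarrow> bool) set" where
  "cube n = {..<n} \<rightarrow>\<^sub>E (UNIV :: bool set)"

definition is_mixture :: "mixture \<Rightarrow> bool" where
  "is_mixture P \<longleftrightarrow>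
     (\<forall>s<ncomp P. 0 \<le> weight P s) \<and> (\<Sum>s<ncomp P. weight P s) = 1"

definition is_subcube_mixture :: "nat \<Rightarrow> mixture \<Rightarrow> bool" where
  "is_subcube_mixture n P \<longleftrightarrow>
     is_mixture P \<and>
     (\<forall>s<ncomp P. \<forall>i<n. pmf (marginal P s i) True \<in> {0, 1/2, 1})"

definition mixture_prob :: "nat \<Rightarrow> mixture \<Rightarrow> (nat \<Rightarrow> bool) \<Rightarrow> real" where
  "mixture_prob n P \<omega> = (\<Sum>s<ncomp P. weight P s * (\<Prod>i<n. pmf (marginal P s i) (\<omega> i)))"

definition d_TV :: "nat \<Rightarrow> mixture \<Rightarrow> mixture \<Rightarrow> real" where
  "d_TV n P Q = 1/2 * (\<Sum>\<omega>\<in>cube n. \<bar>mixture_prob n P \<omega> - mixture_prob n Q \<omega>\<bar>)"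


section \<open>Deterministic programs on a unit-cost real RAM\<close>

text \<open>
  Memory consists of named arrays of natural numbers (used for indices and control) and named
  arrays of real numbers (used for data); a scalar variable is entry 0 of its array. Every
  memory access, constant, arithmetic operation, comparison, assignment and branch costs one
  unit.

  The model is kept weak in order that its unit-cost measure is meaningful. Index arithmetic
  has addition and truncated subtraction only. Real arithmetic has the field operations (with
  \<open>x / 0 = 0\<close>) and order comparison, but no rounding and no conversion to an index. The only
  constants are natural numbers, so that a program cannot carry information inside a real
  constant; in particular, on rational inputs all computed values are rational.
\<close>

type_synonym vname = string

record state =
  nats :: "vname \<Rightarrow> nat \<Rightarrow> nat"
  reals :: "vname \<Rightarrow> nat \<Rightarrow> real"

datatype nexp =
    NConst nat
  | NGet vname nexp
  | NAdd nexp nexp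
  | NSub nexp nexp

datatype rexp =
    RConst nat
  | RGet vname nexp
  | RAdd rexp rexp
  | RSub rexp rexp
  | RMul rexp rexp
  | RDiv rexp rexp

datatype bexp =
    NLess nexp nexp
  | RLess rexp rexp
  | Neg bexp
  | Conj bexp bexp

datatype com =
    Skip
  | NSet vname nexp nexp
  | RSet vname nexp rexp
  | Seq com com
  | Branch bexp com com
  | While bexp com

primrec nval :: "nexp \<Rightarrow> state \<Rightarrow> nat" where
  "nval (NConst c) \<sigma> = c"
| "nval (NGet x e) \<sigma> = nats \<sigma> x (nval e \<sigma>)"
| "nval (NAdd e f) \<sigma> = nval e \<sigma> + nval f \<sigma>"
| "nval (NSub e f) \<sigma> = nval e \<sigma> - nval f \<sigma>"

primrec rval :: "rexp \<Rightarrow> state \<Rightarrow> real" where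
  "rval (RConst c) \<sigma> = real c"
| "rval (RGet x e) \<sigma> = reals \<sigma> x (nval e \<sigma>)"
| "rval (RAdd e f) \<sigma> = rval e \<sigma> + rval f \<sigma>"
| "rval (RSub e f) \<sigma> = rval e \<sigma> - rval f \<sigma>"
| "rval (RMul e f) \<sigma> = rval e \<sigma> * rval f \<sigma>"
| "rval (RDiv e f) \<sigma> = rval e \<sigma> / rval f \<sigma>"

primrec bval :: "bexp \<Rightarrow> state \<Rightarrow> bool" where
  "bval (NLess e f) \<sigma> \<longleftrightarrow> nval e \<sigma> < nval f \<sigma>"
| "bval (RLess e f) \<sigma> \<longleftrightarrow> rval e \<sigma> < rval f \<sigma>"
| "bval (Neg b) \<sigma> \<longleftrightarrow> \<not> bval b \<sigma>"
| "bval (Conj b c) \<sigma> \<longleftrightarrow> bval b \<sigma> \<and> bval c \<sigma>"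

primrec ncost :: "nexp \<Rightarrow> nat" where
  "ncost (NConst c) = 1"
| "ncost (NGet x e) = ncost e + 1"
| "ncost (NAdd e f) = ncost e + ncost f + 1"
| "ncost (NSub e f) = ncost e + ncost f + 1"

primrec rcost :: "rexp \<Rightarrow> nat" where
  "rcost (RConst c) = 1"
| "rcost (RGet x e) = ncost e + 1"
| "rcost (RAdd e f) = rcost e + rcost f + 1"
| "rcost (RSub e f) = rcost e + rcost f + 1"
| "rcost (RMul e f) = rcost e + rcost f + 1"
| "rcost (RDiv e f) = rcost e + rcost f + 1"

primrec bcost :: "bexp \<Rightarrow> nat" where
  "bcost (NLess e f) = ncost e + ncost f + 1"
| "bcost (RLess e f) = rcost e + rcost f + 1"
| "bcost (Neg b) = bcost b + 1"
| "bcost (Conj b c) = bcost b + bcost c + 1"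

definition nset :: "vname \<Rightarrow> nat \<Rightarrow> nat \<Rightarrow> state \<Rightarrow> state" where
  "nset x j v \<sigma> = \<sigma>\<lparr>nats := (nats \<sigma>)(x := (nats \<sigma> x)(j := v))\<rparr>"

definition rset :: "vname \<Rightarrow> nat \<Rightarrow> real \<Rightarrow> state \<Rightarrow> state" where
  "rset x j v \<sigma> = \<sigma>\<lparr>reals := (reals \<sigma>)(x := (reals \<sigma> x)(j := v))\<rparr>"

text \<open>\<open>exec c \<sigma> t \<tau>\<close>: started in \<open>\<sigma>\<close>, the program \<open>c\<close> halts in \<open>\<tau>\<close> after exactly \<open>t\<close> time units.\<close>

inductive exec :: "com \<Rightarrow> state \<Rightarrow> nat \<Rightarrow> state \<Rightarrow> bool" where
  Skip: "exec Skip \<sigma> 1 \<sigma>"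
| NSet: "exec (NSet x i e) \<sigma> (ncost i + ncost e + 1) (nset x (nval i \<sigma>) (nval e \<sigma>) \<sigma>)"
| RSet: "exec (RSet x i e) \<sigma> (ncost i + rcost e + 1) (rset x (nval i \<sigma>) (rval e \<sigma>) \<sigma>)"
| Seq: "exec c \<sigma> t \<sigma>' \<Longrightarrow> exec d \<sigma>' u \<sigma>'' \<Longrightarrow> exec (Seq c d) \<sigma> (t + u) \<sigma>''"
| BranchTrue: "bval b \<sigma> \<Longrightarrow> exec c \<sigma> t \<sigma>' \<Longrightarrow> exec (Branch b c d) \<sigma> (bcost b + t + 1) \<sigma>'"
| BranchFalse: "\<not> bval b \<sigma> \<Longrightarrow> exec d \<sigma> t \<sigma>' \<Longrightarrow> exec (Branch b c d) \<sigma> (bcost b + t + 1) \<sigma>'"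
| WhileFalse: "\<not> bval b \<sigma> \<Longrightarrow> exec (While b c) \<sigma> (bcost b + 1) \<sigma>"
| WhileTrue: "bval b \<sigma> \<Longrightarrow> exec c \<sigma> t \<sigma>' \<Longrightarrow> exec (While b c) \<sigma>' u \<sigma>''
    \<Longrightarrow> exec (While b c) \<sigma> (bcost b + t + u + 1) \<sigma>''"

inductive_cases SkipE: "exec Skip \<sigma> t \<tau>"
inductive_cases NSetE: "exec (NSet x i e) \<sigma> t \<tau>"
inductive_cases RSetE: "exec (RSet x i e) \<sigma> t \<tau>"
inductive_cases SeqE: "exec (Seq c d) \<sigma> t \<tau>"
inductive_cases BranchE: "exec (Branch b c d) \<sigma> t \<tau>"
inductive_cases WhileE: "exec (While b c) \<sigma> t \<tau>"

lemma exec_deterministic: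
  "exec c \<sigma> t \<tau> \<Longrightarrow> exec c \<sigma> t' \<tau>' \<Longrightarrow> t' = t \<and> \<tau>' = \<tau>"
proof (induction arbitrary: t' \<tau>' rule: exec.induct)
  case (Skip \<sigma>)
  then show ?case by (rule SkipE) simp
next
  case (NSet x i e \<sigma>)
  then show ?case by (rule NSetE) simp
next
  case (RSet x i e \<sigma>)
  then show ?case by (rule RSetE) simp
next
  case (Seq c \<sigma> t \<sigma>' d u \<sigma>'')
  from Seq.prems show ?case
    by (rule SeqE) (fastforce dest: Seq.IH)
next
  case (BranchTrue b \<sigma> c t \<sigma>' d)
  from BranchTrue.prems show ?case
    by (rule BranchE) (auto simp: BranchTrue.hyps(1) dest: BranchTrue.IH)
next
  case (BranchFalse b \<sigma> d t \<sigma>' c)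
  from BranchFalse.prems show ?case
    by (rule BranchE) (auto simp: BranchFalse.hyps(1) dest: BranchFalse.IH)
next
  case (WhileFalse b \<sigma> c)
  from WhileFalse.prems show ?case
    by (rule WhileE) (simp_all add: WhileFalse.hyps)
next
  case (WhileTrue b \<sigma> c t \<sigma>' u \<sigma>'')
  from WhileTrue.prems show ?case
    by (rule WhileE) (fastforce simp: WhileTrue.hyps(1) dest: WhileTrue.IH)+
qed


section \<open>Input and output\<close>

text \<open>
  A marginal is presented by its probability of 1. The table of marginals of each mixture is
  stored row by row: the entry of component \<open>s\<close> and coordinate \<open>i\<close> is at index \<open>s * n + i\<close>.
  All memory not holding input is initially 0.
\<close>

definition weight_table :: "mixture \<Rightarrow> nat \<Rightarrow> real" where
  "weight_table P s = (if s < ncomp P then weight P s else 0)"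

definition marginal_table :: "nat \<Rightarrow> mixture \<Rightarrow> nat \<Rightarrow> real" where
  "marginal_table n P j =
     (if j < ncomp P * n then pmf (marginal P (j div n) (j mod n)) True else 0)"

definition input_state :: "nat \<Rightarrow> mixture \<Rightarrow> mixture \<Rightarrow> state" where
  "input_state n P Q =
     \<lparr>nats = (\<lambda>_ _. 0)
        (''n'' := (\<lambda>_. 0)(0 := n),
         ''k1'' := (\<lambda>_. 0)(0 := ncomp P),
         ''k2'' := (\<lambda>_. 0)(0 := ncomp Q)),
      reals = (\<lambda>_ _. 0)
        (''alpha'' := weight_table P,
         ''beta'' := weight_table Q,
         ''P'' := marginal_table n P,
         ''Q'' := marginal_table n Q)\<rparr>"

definition result :: "state \<Rightarrow> real" where
  "result \<sigma> = reals \<sigma> ''out'' 0"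

end

theory Submission imports Defs begin

text \<open>
  Write \<open>p\<^sub>s \<omega> = v\<^sub>s * 1\<^sub>s \<omega>\<close> for the signed contribution of component \<open>s\<close> to \<open>P - Q\<close>, where \<open>1\<^sub>s\<close> is
  the indicator of its subcube and \<open>v\<^sub>s\<close> a constant. For every function \<open>h\<close>,
  \<open>h (\<Sum>\<^sub>s v\<^sub>s * 1\<^sub>s \<omega>)\<close> is the sum over all disjoint pairs \<open>(S, T)\<close> of sets of components of
  \<open>(-1)^|T| * h (\<Sum>s\<in>S. v\<^sub>s) * (\<Prod>s\<in>S \<union> T. 1\<^sub>s \<omega>)\<close>, that is, inclusion-exclusion applied to the
  set of subcubes containing \<open>\<omega>\<close>. Take \<open>h = abs\<close> and sum over \<open>\<omega>\<close>: the intersection of the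
  subcubes in \<open>S \<union> T\<close> is again a subcube (or empty), so its size is a product over coordinates.
  The \<open>3^k\<close> pairs are kept in a table that triples with every component; each table entry
  costs \<open>O(n)\<close>.
\<close>

section \<open>Weakest preconditions with running time\<close>

text \<open>The running time is an argument of the postcondition, so correctness and cost are proved
  together. Only halting runs count and \<open>exec\<close> is deterministic, so the existence of a
  run amounts to total correctness.\<close>

definition wp :: "com \<Rightarrow> (nat \<Rightarrow> state \<Rightarrow> bool) \<Rightarrow> state \<Rightarrow> bool" where
  "wp c R \<sigma> \<longleftrightarrow> (\<exists>t \<tau>. exec c \<sigma> t \<tau> \<and> R t \<tau>)"

lemma wp_Skip [simp]: "wp Skip R \<sigma> \<longleftrightarrow> R 1 \<sigma>"
  unfolding wp_def by (metis SkipE exec.Skip)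

lemma wp_NSet [simp]:
  "wp (NSet x i e) R \<sigma> \<longleftrightarrow> R (ncost i + ncost e + 1) (nset x (nval i \<sigma>) (nval e \<sigma>) \<sigma>)"
  unfolding wp_def by (metis NSetE exec.NSet)

lemma wp_RSet [simp]:
  "wp (RSet x i e) R \<sigma> \<longleftrightarrow> R (ncost i + rcost e + 1) (rset x (nval i \<sigma>) (rval e \<sigma>) \<sigma>)"
  unfolding wp_def by (metis RSetE exec.RSet)

lemma wp_Seq [simp]: "wp (Seq c d) R \<sigma> \<longleftrightarrow> wp c (\<lambda>t. wp d (\<lambda>u. R (t + u))) \<sigma>"
  unfolding wp_def by (blast elim: SeqE intro: exec.Seq)

lemma wp_Branch [simp]:
  "wp (Branch b c d) R \<sigma> \<longleftrightarrow> wp (if bval b \<sigma> then c else d) (\<lambda>t. R (bcost b + t + 1)) \<sigma>"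
  proof
  assume "wp (Branch b c d) R \<sigma>"
  then show "wp (if bval b \<sigma> then c else d) (\<lambda>t. R (bcost b + t + 1)) \<sigma>"
    unfolding wp_def by (auto elim!: BranchE)
next
  assume "wp (if bval b \<sigma> then c else d) (\<lambda>t. R (bcost b + t + 1)) \<sigma>"
  then obtain t \<tau> where "exec (if bval b \<sigma> then c else d) \<sigma> t \<tau>" "R (bcost b + t + 1) \<tau>"
    unfolding wp_def by blast
  moreover from this(1) have "exec (Branch b c d) \<sigma> (bcost b + t + 1) \<tau>"
    by (cases "bval b \<sigma>") (auto intro: exec.BranchTrue[simplified] exec.BranchFalse[simplified])
  ultimately show "wp (Branch b c d) R \<sigma>"
    unfolding wp_def by blast
qed

text \<open>Runs are unique, so a run already obtained for \<open>c\<close> can be substituted into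
  any larger program containing \<open>c\<close>, whatever the postcondition.\<close>

lemma wp_exec: "exec c \<sigma> t \<tau> \<Longrightarrow> wp c R \<sigma> \<longleftrightarrow> R t \<tau>"
  unfolding wp_def by (blast dest: exec_deterministic)

lemma wp_mono: "wp c R \<sigma> \<Longrightarrow> (\<And>t \<tau>. R t \<tau> \<Longrightarrow> R' t \<tau>) \<Longrightarrow> wp c R' \<sigma>"
  unfolding wp_def by blast

text \<open>The invariant depends on the number of finished iterations and on the time spent so far.
  As the number \<open>N\<close> of iterations is known in advance, termination needs no separate
  measure.\<close>

lemma wp_While:
  assumes init: "I 0 0 \<sigma>"
    and step: "\<And>j t \<tau>. j < N \<Longrightarrow> I j t \<tau> \<Longrightarrow>
      bval b \<tau> \<and> wp c (\<lambda>u. I (Suc j) (bcost b + t + u + 1)) \<tau>"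
    and final: "\<And>t \<tau>. I N t \<tau> \<Longrightarrow> \<not> bval b \<tau> \<and> R (bcost b + t + 1) \<tau>"
  shows "wp (While b c) R \<sigma>"
proof -
  \<comment> \<open>Induction on the number \<open>N - j\<close> of iterations left;
    \<open>t\<close> is the time already spent.\<close>
  have "\<exists>u \<rho>. exec (While b c) \<tau> u \<rho> \<and> R (t + u) \<rho>" if "I j t \<tau>" "j \<le> N" for j t \<tau>
    using that
  proof (induction "N - j" arbitrary: j t \<tau>)
    case 0
    then have "I N t \<tau>"
      by simp
    from final[OF this] WhileFalse[of b \<tau> c] show ?case
      by (intro exI[of _ "bcost b + 1"] exI[of _ \<tau>]) (simp add: add_ac)
  next
    case (Suc l)
    then have "j < N"
      by simp
    from step[OF this Suc.prems(1)] obtain u \<rho> where b: "bval b \<tau>" and u: "exec c \<tau> u \<rho>"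
      and I: "I (Suc j) (bcost b + t + u + 1) \<rho>"
      unfolding wp_def by blast
    have "l = N - Suc j" "Suc j \<le> N"
      using Suc.hyps(2) \<open>j < N\<close> by simp_all
    from Suc.hyps(1)[OF this(1) I this(2)] obtain u' \<rho>' where
      "exec (While b c) \<rho> u' \<rho>'" "R (bcost b + t + u + 1 + u') \<rho>'"
      by blast
    with WhileTrue[OF b u] show ?case
      by (intro exI[of _ "bcost b + u + u' + 1"] exI[of _ \<rho>']) (simp add: add_ac)
  qed
  from this[OF init] show ?thesis
    unfolding wp_def by simp
qed

lemma nats_nset [simp]: "nats (nset x j v \<sigma>) = (nats \<sigma>)(x := (nats \<sigma> x)(j := v))"
  and reals_nset [simp]: "reals (nset x j v \<sigma>) = reals \<sigma>"
  and nats_rset [simp]: "nats (rset x j r \<sigma>) = nats \<sigma>"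
  and reals_rset [simp]: "reals (rset x j r \<sigma>) = (reals \<sigma>)(x := (reals \<sigma> x)(j := r))"
  by (simp_all add: nset_def rset_def)

text \<open>A frame condition: the two sets name the arrays of naturals and of reals that a program
  may write.\<close>

definition agree :: "vname set \<Rightarrow> vname set \<Rightarrow> state \<Rightarrow> state \<Rightarrow> bool" where
  "agree X Y \<sigma> \<tau> \<longleftrightarrow> (\<forall>x. x \<notin> X \<longrightarrow> nats \<tau> x = nats \<sigma> x) \<and> (\<forall>y. y \<notin> Y \<longrightarrow> reals \<tau> y = reals \<sigma> y)"

lemma agree_trans: "agree X Y \<sigma> \<tau> \<Longrightarrow> agree X Y \<tau> \<rho> \<Longrightarrow> agree X Y \<sigma> \<rho>"
  unfolding agree_def by auto

section \<open>Inclusion-exclusion over subcubes\<close>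

text \<open>
  The polynomials \<open>supp\<close> and \<open>mass\<close> factor \<open>x \<in> {0, 1/2, 1}\<close> into its support indicator and the
  mass of the points of the support, without branching.
\<close>

definition marg :: "real \<Rightarrow> bool \<Rightarrow> real" where
  "marg p b = (if b then p else 1 - p)"

definition supp :: "real \<Rightarrow> real" where
  "supp x = x * (3 - 2 * x)"

definition mass :: "real \<Rightarrow> real" where
  "mass p = 1 - 2 * (p * (1 - p))"

lemma supp_marg_bool: "p \<in> {0, 1/2, 1} \<Longrightarrow> supp (marg p b) \<in> {0, 1}"
  by (elim insertE emptyE; hypsubst; simp add: supp_def marg_def)

lemma mass_supp_marg: "p \<in> {0, 1/2, 1} \<Longrightarrow> mass p * supp (marg p b) = marg p b"
  by (elim insertE emptyE; hypsubst; simp add: supp_def marg_def mass_def)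

text \<open>Row \<open>m\<close> stands for a pair (S, T): \<open>g\<close> is its sign,
  \<open>W\<close> its value, \<open>Z\<close> its support in each coordinate. Validity for every
  \<open>h\<close>, not just for \<open>abs\<close>, makes the identity inductive, because a new
  component shifts the argument of \<open>h\<close>.\<close>

definition expands ::
  "nat \<Rightarrow> nat \<Rightarrow> (nat \<Rightarrow> real) \<Rightarrow> (nat \<Rightarrow> real) \<Rightarrow> (bool \<Rightarrow> nat \<Rightarrow> real) \<Rightarrow> ((nat \<Rightarrow> bool) \<Rightarrow> real) \<Rightarrow> bool"
  where "expands n N g W Z D \<longleftrightarrow>
    (\<forall>\<omega> (h :: real \<Rightarrow> real). (\<Sum>m<N. g m * h (W m) * (\<Prod>i<n. Z (\<omega> i) (m * n + i))) = h (D \<omega>))"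

lemma sum_lessThan_add:
  fixes f :: "nat \<Rightarrow> real"
  shows "(\<Sum>m<M + N. f m) = (\<Sum>m<M. f m) + (\<Sum>m<N. f (m + M))"
  by (induction N) (simp_all add: algebra_simps)

lemma expands_init:
  "g 0 = 1 \<Longrightarrow> W 0 = 0 \<Longrightarrow> (\<And>b i. i < n \<Longrightarrow> Z b i = 1) \<Longrightarrow> expands n (Suc 0) g W Z (\<lambda>_. 0)"
  by (simp add: expands_def)

text \<open>
  A component with support indicator \<open>x\<close> and value \<open>v\<close> turns \<open>h D\<close> into
  \<open>h (D + v * x) = h D + x * h (D + v) - x * h D\<close>; the three terms are the three new blocks.
\<close>

lemma expands_step:
  assumes E: "expands n N g W Z D"
    and p: "\<And>i. i < n \<Longrightarrow> p i \<in> {0, 1/2, 1}"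
    and v: "v = w * (\<Prod>i<n. mass (p i))"
    and W': "\<And>m. m < N \<Longrightarrow> W' m = W m \<and> W' (m + N) = W m + v \<and> W' (m + N + N) = W m"
    and g': "\<And>m. m < N \<Longrightarrow> g' m = g m \<and> g' (m + N) = g m \<and> g' (m + N + N) = - g m"
    and Z': "\<And>b a. a < N * n \<Longrightarrow> Z' b a = Z b a
      \<and> Z' b (a + N * n) = Z b a * supp (marg (p (a mod n)) b)
      \<and> Z' b (a + N * n + N * n) = Z b a * supp (marg (p (a mod n)) b)"
  shows "expands n (3 * N) g' W' Z' (\<lambda>\<omega>. D \<omega> + w * (\<Prod>i<n. marg (p i) (\<omega> i)))"
  unfolding expands_def
proof (intro allI)
  fix \<omega> and h :: "real \<Rightarrow> real"
  define x where "x = (\<Prod>i<n. supp (marg (p i) (\<omega> i)))"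
  define z where "z m = (\<Prod>i<n. Z (\<omega> i) (m * n + i))" for m
  have x01: "x = 0 \<or> x = 1"
  proof (cases "\<exists>i<n. supp (marg (p i) (\<omega> i)) = 0")
    case True
    then show ?thesis
      by (auto simp: x_def)
  next
    case False
    then have "\<forall>i<n. supp (marg (p i) (\<omega> i)) = 1"
      using supp_marg_bool[OF p] by fastforce
    then show ?thesis
      by (simp add: x_def)
  qed
  \<comment> \<open>Coordinatewise, \<open>mass\<close> restores the constant factor that
    \<open>supp\<close> normalises away.\<close>
  have vx: "v * x = w * (\<Prod>i<n. marg (p i) (\<omega> i))"
    unfolding v x_def mult.assoc prod.distrib[symmetric]
    by (intro arg_cong[where f = "(*) w"] prod.cong refl) (simp only: lessThan_iff mass_supp_marg p)
  \<comment> \<open>Row \<open>m\<close> of \<open>Z\<close> fills the entries from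
    \<open>m * n\<close> up to \<open>m * n + n - 1\<close>, so going down \<open>N\<close> rows is
    a shift by \<open>N * n\<close> entries.\<close>
  have idx: "m * n + i < N * n" if "m < N" "i < n" for m i
  proof -
    have "m * n + i < Suc m * n"
      using that by simp
    also have "\<dots> \<le> N * n"
      using that by (intro mult_right_mono) auto
    finally show ?thesis .
  qed
  have z0: "(\<Prod>i<n. Z' (\<omega> i) (m * n + i)) = z m" if "m < N" for m
    unfolding z_def using that by (intro prod.cong) (simp_all add: Z' idx)
  have z1: "(\<Prod>i<n. Z' (\<omega> i) ((m + N) * n + i)) = z m * x" if "m < N" for m
    unfolding z_def x_def prod.distrib[symmetric]
  proof (intro prod.cong refl)
    fix i assume "i \<in> {..<n}"
    with that Z'[OF idx, of m i "\<omega> i"]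
    show "Z' (\<omega> i) ((m + N) * n + i) = Z (\<omega> i) (m * n + i) * supp (marg (p i) (\<omega> i))"
      by (simp add: algebra_simps)
  qed
  have z2: "(\<Prod>i<n. Z' (\<omega> i) ((m + N + N) * n + i)) = z m * x" if "m < N" for m
    unfolding z_def x_def prod.distrib[symmetric]
  proof (intro prod.cong refl)
    fix i assume "i \<in> {..<n}"
    with that Z'[OF idx, of m i "\<omega> i"]
    show "Z' (\<omega> i) ((m + N + N) * n + i) = Z (\<omega> i) (m * n + i) * supp (marg (p i) (\<omega> i))"
      by (simp add: algebra_simps)
  qed
  have N3: "3 * N = N + N + N"
    by simp
  have E': "(\<Sum>m<N. g m * h' (W m) * z m) = h' (D \<omega>)" for h' :: "real \<Rightarrow> real"
    using E unfolding expands_def z_def by blast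
  have "(\<Sum>m<3 * N. g' m * h (W' m) * (\<Prod>i<n. Z' (\<omega> i) (m * n + i)))
      = (\<Sum>m<N. g m * h (W m) * z m) + (\<Sum>m<N. g m * h (W m + v) * (z m * x))
        + (\<Sum>m<N. - g m * h (W m) * (z m * x))"
    unfolding N3 sum_lessThan_add
    by (intro arg_cong2[where f = "(+)"] sum.cong refl)
       (auto simp: W' g' z0 z1 z2 add.assoc[symmetric])
  also have "\<dots> = (\<Sum>m<N. g m * h (W m) * z m) + (\<Sum>m<N. g m * h (W m + v) * z m) * x
      - (\<Sum>m<N. g m * h (W m) * z m) * x"
    by (simp add: sum_distrib_right sum_negf mult.assoc)
  \<comment> \<open>The middle term comes from the hypothesis at the shifted function
    \<open>h (y + v)\<close>.\<close>
  also have "\<dots> = h (D \<omega>) + h (D \<omega> + v) * x - h (D \<omega>) * x"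
    using E'[of h] E'[of "\<lambda>y. h (y + v)"] by simp
  \<comment> \<open>Since \<open>h\<close> is arbitrary, this rests on \<open>x\<close> being 0 or
    1.\<close>
  also have "\<dots> = h (D \<omega> + v * x)"
    using x01 by auto
  finally show "(\<Sum>m<3 * N. g' m * h (W' m) * (\<Prod>i<n. Z' (\<omega> i) (m * n + i)))
      = h (D \<omega> + w * (\<Prod>i<n. marg (p i) (\<omega> i)))"
    by (simp add: vx)
qed

text \<open>Take \<open>h\<close> to be \<open>abs\<close> and sum over the cube. After exchanging
  the sums, distributivity turns the inner sum over \<omega> into a product over
  coordinates.\<close>

lemma expands_sum_abs:
  assumes "expands n N g W Z D"
  shows "(\<Sum>m<N. g m * \<bar>W m\<bar> * (\<Prod>i<n. Z False (m * n + i) + Z True (m * n + i)))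
    = (\<Sum>\<omega>\<in>cube n. \<bar>D \<omega>\<bar>)"
proof -
  have "(\<Prod>i<n. Z False (m * n + i) + Z True (m * n + i))
      = (\<Sum>\<omega>\<in>cube n. \<Prod>i<n. Z (\<omega> i) (m * n + i))" for m
    unfolding cube_def by (subst prod_sum_PiE[symmetric]) (simp_all add: UNIV_bool)
  then have "(\<Sum>m<N. g m * \<bar>W m\<bar> * (\<Prod>i<n. Z False (m * n + i) + Z True (m * n + i)))
      = (\<Sum>\<omega>\<in>cube n. \<Sum>m<N. g m * \<bar>W m\<bar> * (\<Prod>i<n. Z (\<omega> i) (m * n + i)))"
    by (simp add: sum_distrib_left sum.swap[of _ "cube n"])
  also have "\<dots> = (\<Sum>\<omega>\<in>cube n. \<bar>D \<omega>\<bar>)"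
    using assms unfolding expands_def by (intro sum.cong refl) (rule spec[where x = abs], blast)
  finally show ?thesis .
qed

section \<open>Program for adding one component to the table\<close>

abbreviation nv :: "vname \<Rightarrow> nexp" where
  "nv x \<equiv> NGet x (NConst 0)"

abbreviation rv :: "vname \<Rightarrow> rexp" where
  "rv x \<equiv> RGet x (NConst 0)"

abbreviation nlet :: "vname \<Rightarrow> nexp \<Rightarrow> com" where
  "nlet x \<equiv> NSet x (NConst 0)"

abbreviation rlet :: "vname \<Rightarrow> rexp \<Rightarrow> com" where
  "rlet x \<equiv> RSet x (NConst 0)"

abbreviation incr :: "vname \<Rightarrow> com" where
  "incr x \<equiv> nlet x (NAdd (nv x) (NConst 1))"

primrec block :: "com list \<Rightarrow> com" where
  "block [] = Skip"
| "block (c # cs) = (if cs = [] then c else Seq c (block cs))"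

abbreviation Zarr :: "bool \<Rightarrow> vname" where
  "Zarr b \<equiv> (if b then ''Z1'' else ''Z0'')"

text \<open>\<open>sg\<close> is 1 for components of \<open>P\<close> and -1 for those of
  \<open>Q\<close>; \<open>b\<close> is the offset of the row of component \<open>s\<close> in its
  table of marginals. The result \<open>v\<close> is the signed value that the component takes on
  its subcube.\<close>

definition value_com :: "vname \<Rightarrow> vname \<Rightarrow> com" where
  "value_com w p = block
    [rlet ''v'' (RMul (rv ''sg'') (RGet w (nv ''s''))),
     nlet ''i'' (NConst 0),
     While (NLess (nv ''i'') (nv ''n'')) (block
       [rlet ''v'' (RMul (rv ''v'') (RSub (RConst 1) (RMul (RConst 2)
          (RMul (RGet p (NAdd (nv ''b'') (nv ''i'')))
            (RSub (RConst 1) (RGet p (NAdd (nv ''b'') (nv ''i'')))))))),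
        incr ''i''])]"

lemma value_com:
  assumes "p \<notin> {''v''}" "w \<notin> {''v''}"
  shows "wp (value_com w p) (\<lambda>t \<tau>. agree {''i''} {''v''} \<sigma> \<tau>
      \<and> reals \<tau> ''v'' 0 = reals \<sigma> ''sg'' 0 * reals \<sigma> w (nats \<sigma> ''s'' 0)
          * (\<Prod>i<nats \<sigma> ''n'' 0. mass (reals \<sigma> p (nats \<sigma> ''b'' 0 + i)))
      \<and> t \<le> 50 * nats \<sigma> ''n'' 0 + 50) \<sigma>"
  unfolding value_com_def
  apply simp
  apply (rule wp_While[where N = "nats \<sigma> ''n'' 0" and
     I = "\<lambda>j t \<tau>. agree {''i''} {''v''} \<sigma> \<tau> \<and> nats \<tau> ''i'' 0 = j \<and> t \<le> 50 * j
       \<and> reals \<tau> ''v'' 0 = reals \<sigma> ''sg'' 0 * reals \<sigma> w (nats \<sigma> ''s'' 0)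
          * (\<Prod>i<j. mass (reals \<sigma> p (nats \<sigma> ''b'' 0 + i)))"])
  using assms
  by (simp_all add: agree_def mass_def)

text \<open>The three blocks of rows leave the new component out of the pair, put it into S, and put
  it into T. Only S counts in the value; membership in T flips the sign.\<close>

definition split_com :: com where
  "split_com = block
    [nlet ''m'' (NConst 0),
     While (NLess (nv ''m'') (nv ''N'')) (block
       [RSet ''W'' (NAdd (nv ''m'') (nv ''N'')) (RAdd (RGet ''W'' (nv ''m'')) (rv ''v'')),
        RSet ''W'' (NAdd (NAdd (nv ''m'') (nv ''N'')) (nv ''N'')) (RGet ''W'' (nv ''m'')),
        RSet ''g'' (NAdd (nv ''m'') (nv ''N'')) (RGet ''g'' (nv ''m'')),
        RSet ''g'' (NAdd (NAdd (nv ''m'') (nv ''N'')) (nv ''N''))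
          (RSub (RConst 0) (RGet ''g'' (nv ''m''))),
        incr ''m''])]"

lemma split_com:
  "wp split_com (\<lambda>t \<tau>. agree {''m''} {''W'', ''g''} \<sigma> \<tau>
      \<and> (\<forall>m < nats \<sigma> ''N'' 0.
          reals \<tau> ''W'' m = reals \<sigma> ''W'' m
        \<and> reals \<tau> ''W'' (m + nats \<sigma> ''N'' 0) = reals \<sigma> ''W'' m + reals \<sigma> ''v'' 0
        \<and> reals \<tau> ''W'' (m + nats \<sigma> ''N'' 0 + nats \<sigma> ''N'' 0) = reals \<sigma> ''W'' m
        \<and> reals \<tau> ''g'' m = reals \<sigma> ''g'' m
        \<and> reals \<tau> ''g'' (m + nats \<sigma> ''N'' 0) = reals \<sigma> ''g'' m
        \<and> reals \<tau> ''g'' (m + nats \<sigma> ''N'' 0 + nats \<sigma> ''N'' 0) = - reals \<sigma> ''g'' m)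
      \<and> t \<le> 70 * nats \<sigma> ''N'' 0 + 50) \<sigma>"
  unfolding split_com_def
  apply simp
  \<comment> \<open>Reads stay below position \<open>N\<close> and writes go to positions from
    \<open>N\<close> on, so the first block stays intact.\<close>
  apply (rule wp_While[where N = "nats \<sigma> ''N'' 0" and
     I = "\<lambda>j t \<tau>. agree {''m''} {''W'', ''g''} \<sigma> \<tau> \<and> nats \<tau> ''m'' 0 = j \<and> t \<le> 70 * j
      \<and> (\<forall>m < nats \<sigma> ''N'' 0.
          reals \<tau> ''W'' m = reals \<sigma> ''W'' m \<and> reals \<tau> ''g'' m = reals \<sigma> ''g'' m)
      \<and> (\<forall>m < j.
          reals \<tau> ''W'' (m + nats \<sigma> ''N'' 0) = reals \<sigma> ''W'' m + reals \<sigma> ''v'' 0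
        \<and> reals \<tau> ''W'' (m + nats \<sigma> ''N'' 0 + nats \<sigma> ''N'' 0) = reals \<sigma> ''W'' m
        \<and> reals \<tau> ''g'' (m + nats \<sigma> ''N'' 0) = reals \<sigma> ''g'' m
        \<and> reals \<tau> ''g'' (m + nats \<sigma> ''N'' 0 + nats \<sigma> ''N'' 0) = - reals \<sigma> ''g'' m)"])
  subgoal
    by (simp add: agree_def)
  subgoal for j t \<tau>
    apply (intro conjI)
    subgoal by (simp add: agree_def)
    subgoal by (simp add: agree_def less_Suc_eq)
    done
  subgoal by (simp add: agree_def)
  done

definition support_exp :: "vname \<Rightarrow> bool \<Rightarrow> rexp" where
  "support_exp p b =
    (let x = RGet p (NAdd (nv ''b'') (nv ''i'')); y = if b then x else RSub (RConst 1) x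
     in RMul y (RSub (RConst 3) (RMul (RConst 2) y)))"

lemma rval_support_exp [simp]:
  "rval (support_exp p b) \<sigma> = supp (marg (reals \<sigma> p (nats \<sigma> ''b'' 0 + nats \<sigma> ''i'' 0)) b)"
  by (simp add: support_exp_def supp_def marg_def Let_def)

lemma rcost_support_exp [simp]: "rcost (support_exp p b) = (if b then 17 else 21)"
  by (simp add: support_exp_def Let_def)

text \<open>Both new blocks belong to the same subcube, the old one intersected with that of the
  component, so the third block copies the second.\<close>

definition restrict_com :: "vname \<Rightarrow> bool \<Rightarrow> com" where
  "restrict_com p b = block
    [RSet (Zarr b) (NAdd (nv ''a'') (nv ''L''))
       (RMul (RGet (Zarr b) (nv ''a'')) (support_exp p b)),
     RSet (Zarr b) (NAdd (NAdd (nv ''a'') (nv ''L'')) (nv ''L''))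
       (RGet (Zarr b) (NAdd (nv ''a'') (nv ''L'')))]"

text \<open>One flat index \<open>a\<close> traverses all rows. Index arithmetic has no division, so
  \<open>i\<close> is a counter kept equal to \<open>a mod n\<close>.\<close>

definition copy_com :: "vname \<Rightarrow> com" where
  "copy_com p = block
    [nlet ''a'' (NConst 0),
     nlet ''i'' (NConst 0),
     While (NLess (nv ''a'') (nv ''L'')) (block
       [restrict_com p False,
        restrict_com p True,
        incr ''a'',
        incr ''i'',
        Branch (NLess (nv ''i'') (nv ''n'')) Skip (nlet ''i'' (NConst 0))])]"

lemma copy_com:
  assumes p: "p \<notin> {''Z0'', ''Z1''}"
    and n: "nats \<sigma> ''n'' 0 = n" "n \<ge> 1" and L: "nats \<sigma> ''L'' 0 = L"
  shows "wp (copy_com p) (\<lambda>t \<tau>. agree {''a'', ''i''} {''Z0'', ''Z1''} \<sigma> \<tau>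
      \<and> (\<forall>b. \<forall>a < L.
          reals \<tau> (Zarr b) a = reals \<sigma> (Zarr b) a
        \<and> reals \<tau> (Zarr b) (a + L)
          = reals \<sigma> (Zarr b) a * supp (marg (reals \<sigma> p (nats \<sigma> ''b'' 0 + a mod n)) b)
        \<and> reals \<tau> (Zarr b) (a + L + L)
          = reals \<sigma> (Zarr b) a * supp (marg (reals \<sigma> p (nats \<sigma> ''b'' 0 + a mod n)) b))
      \<and> t \<le> 200 * L + 50) \<sigma>"
proof -
  \<comment> \<open>Unless the incremented counter has reached \<open>n\<close>, the guard of the
    branch holds; this matches the case distinction of \<open>mod_Suc\<close>.\<close>
  have mod_lt: "Suc (j mod n) < n" if "Suc (j mod n) \<noteq> n" for j
    using that n(2) by (intro Suc_lessI) simp_all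
  show ?thesis
    unfolding copy_com_def
    apply simp
    apply (rule wp_While[where N = L and
       I = "\<lambda>j t \<tau>. agree {''a'', ''i''} {''Z0'', ''Z1''} \<sigma> \<tau>
        \<and> nats \<tau> ''a'' 0 = j \<and> nats \<tau> ''i'' 0 = j mod n \<and> t \<le> 200 * j
        \<and> (\<forall>b. \<forall>a < L. reals \<tau> (Zarr b) a = reals \<sigma> (Zarr b) a)
        \<and> (\<forall>b. \<forall>a < j.
            reals \<tau> (Zarr b) (a + L)
            = reals \<sigma> (Zarr b) a * supp (marg (reals \<sigma> p (nats \<sigma> ''b'' 0 + a mod n)) b)
          \<and> reals \<tau> (Zarr b) (a + L + L)
            = reals \<sigma> (Zarr b) a * supp (marg (reals \<sigma> p (nats \<sigma> ''b'' 0 + a mod n)) b))"])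
    subgoal
      by (simp add: agree_def)
    subgoal for j t \<tau>
      using assms
      apply (intro conjI)
      subgoal by (simp add: agree_def)
      subgoal by (simp add: restrict_com_def agree_def all_bool_eq less_Suc_eq mod_Suc mod_lt)
      done
    subgoal
      using assms by (simp add: agree_def all_bool_eq)
    done
qed

text \<open>\<open>N\<close> counts the rows and \<open>L\<close> the entries of each support table.
  Both are tripled by addition, as indices cannot be multiplied, and only after the loops that use
  the old sizes.\<close>

definition component_com :: "vname \<Rightarrow> vname \<Rightarrow> com" where
  "component_com w p = block
    [value_com w p,
     split_com,
     copy_com p,
     nlet ''N'' (NAdd (NAdd (nv ''N'') (nv ''N'')) (nv ''N'')),
     nlet ''L'' (NAdd (NAdd (nv ''L'') (nv ''L'')) (nv ''L'')),
     nlet ''b'' (NAdd (nv ''b'') (nv ''n'')),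
     incr ''s'']"

text \<open>
  For \<open>m < N\<close> and \<open>i < n\<close>, \<open>g\<close>, \<open>W\<close> at \<open>m\<close> hold the sign and the value of the \<open>m\<close>-th pair, and
  \<open>Z0\<close>, \<open>Z1\<close> at \<open>m * n + i\<close> tell whether its subcube allows 0, 1 in coordinate \<open>i\<close>.
\<close>

definition table :: "nat \<Rightarrow> nat \<Rightarrow> ((nat \<Rightarrow> bool) \<Rightarrow> real) \<Rightarrow> state \<Rightarrow> bool" where
  "table n N D \<sigma> \<longleftrightarrow> nats \<sigma> ''n'' 0 = n \<and> nats \<sigma> ''N'' 0 = N \<and> nats \<sigma> ''L'' 0 = N * n
    \<and> expands n N (reals \<sigma> ''g'') (reals \<sigma> ''W'') (\<lambda>b. reals \<sigma> (Zarr b)) D"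

text \<open>Passing from \<open>P\<close> to \<open>Q\<close> changes the sign variable, and the
  table built so far must survive this.\<close>

lemma table_sign [simp]: "table n N D (rset ''sg'' 0 v \<sigma>) \<longleftrightarrow> table n N D \<sigma>"
proof -
  have "Zarr b \<noteq> ''sg''" for b
    by simp
  then show ?thesis
    by (simp add: table_def)
qed

abbreviation index_vars :: "vname set" where
  "index_vars \<equiv> {''i'', ''m'', ''a'', ''N'', ''L'', ''b'', ''s''}"

abbreviation table_vars :: "vname set" where
  "table_vars \<equiv> {''v'', ''W'', ''g'', ''Z0'', ''Z1''}"

lemma component_com:
  assumes T: "table n N D \<sigma>" and pos: "n \<ge> 1" "N \<ge> 1"
    and names: "w \<notin> table_vars" "p \<notin> table_vars"
    and p: "\<And>i. i < n \<Longrightarrow> reals \<sigma> p (nats \<sigma> ''b'' 0 + i) \<in> {0, 1/2, 1}"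
  shows "wp (component_com w p) (\<lambda>t \<tau>. agree index_vars table_vars \<sigma> \<tau>
      \<and> table n (3 * N) (\<lambda>\<omega>. D \<omega> + reals \<sigma> ''sg'' 0 * reals \<sigma> w (nats \<sigma> ''s'' 0)
          * (\<Prod>i<n. marg (reals \<sigma> p (nats \<sigma> ''b'' 0 + i)) (\<omega> i))) \<tau>
      \<and> nats \<tau> ''s'' 0 = Suc (nats \<sigma> ''s'' 0) \<and> nats \<tau> ''b'' 0 = nats \<sigma> ''b'' 0 + n
      \<and> t \<le> 700 * (N * n)) \<sigma>"
proof -
  have n: "nats \<sigma> ''n'' 0 = n" and N: "nats \<sigma> ''N'' 0 = N" and L: "nats \<sigma> ''L'' 0 = N * n"
    and E: "expands n N (reals \<sigma> ''g'') (reals \<sigma> ''W'') (\<lambda>b. reals \<sigma> (Zarr b)) D"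
    using T by (simp_all add: table_def)
  define v where "v = reals \<sigma> ''sg'' 0 * reals \<sigma> w (nats \<sigma> ''s'' 0)
    * (\<Prod>i<n. mass (reals \<sigma> p (nats \<sigma> ''b'' 0 + i)))"
  from value_com[of p w \<sigma>] names obtain t1 \<sigma>1 where
    1: "exec (value_com w p) \<sigma> t1 \<sigma>1" "agree {''i''} {''v''} \<sigma> \<sigma>1"
      "reals \<sigma>1 ''v'' 0 = v" "t1 \<le> 50 * n + 50"
    unfolding wp_def n v_def by auto
  have A1: "\<And>x. x \<noteq> ''i'' \<Longrightarrow> nats \<sigma>1 x = nats \<sigma> x" "\<And>x. x \<noteq> ''v'' \<Longrightarrow> reals \<sigma>1 x = reals \<sigma> x"
    using 1(2) by (auto simp: agree_def)
  from split_com[of \<sigma>1] obtain t2 \<sigma>2 where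
    2: "exec split_com \<sigma>1 t2 \<sigma>2" "agree {''m''} {''W'', ''g''} \<sigma>1 \<sigma>2"
      "\<And>m. m < N \<Longrightarrow>
          reals \<sigma>2 ''W'' m = reals \<sigma> ''W'' m
        \<and> reals \<sigma>2 ''W'' (m + N) = reals \<sigma> ''W'' m + v
        \<and> reals \<sigma>2 ''W'' (m + N + N) = reals \<sigma> ''W'' m"
      "\<And>m. m < N \<Longrightarrow>
          reals \<sigma>2 ''g'' m = reals \<sigma> ''g'' m
        \<and> reals \<sigma>2 ''g'' (m + N) = reals \<sigma> ''g'' m
        \<and> reals \<sigma>2 ''g'' (m + N + N) = - reals \<sigma> ''g'' m"
      "t2 \<le> 70 * N + 50"
    unfolding wp_def by (auto simp: A1 N 1(3))
  have A2: "\<And>x. x \<notin> {''i'', ''m''} \<Longrightarrow> nats \<sigma>2 x = nats \<sigma> x"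
      "\<And>x. x \<notin> {''v'', ''W'', ''g''} \<Longrightarrow> reals \<sigma>2 x = reals \<sigma> x"
    using 2(2) by (auto simp: agree_def A1)
  from copy_com[of p \<sigma>2 n "N * n"] names pos obtain t3 \<sigma>3 where
    3: "exec (copy_com p) \<sigma>2 t3 \<sigma>3" "agree {''a'', ''i''} {''Z0'', ''Z1''} \<sigma>2 \<sigma>3"
      "\<And>b a. a < N * n \<Longrightarrow>
          reals \<sigma>3 (Zarr b) a = reals \<sigma> (Zarr b) a
        \<and> reals \<sigma>3 (Zarr b) (a + N * n)
          = reals \<sigma> (Zarr b) a * supp (marg (reals \<sigma> p (nats \<sigma> ''b'' 0 + a mod n)) b)
        \<and> reals \<sigma>3 (Zarr b) (a + N * n + N * n)
          = reals \<sigma> (Zarr b) a * supp (marg (reals \<sigma> p (nats \<sigma> ''b'' 0 + a mod n)) b)"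
      "t3 \<le> 200 * (N * n) + 50"
    unfolding wp_def by (auto simp: A2 n L)
  have A3: "\<And>x. x \<notin> {''i'', ''m'', ''a''} \<Longrightarrow> nats \<sigma>3 x = nats \<sigma> x"
      "\<And>x. x \<notin> table_vars \<Longrightarrow> reals \<sigma>3 x = reals \<sigma> x"
      "reals \<sigma>3 ''W'' = reals \<sigma>2 ''W''" "reals \<sigma>3 ''g'' = reals \<sigma>2 ''g''"
    using 3(2) by (auto simp: agree_def A2)
  have E3: "expands n (3 * N) (reals \<sigma>3 ''g'') (reals \<sigma>3 ''W'') (\<lambda>b. reals \<sigma>3 (Zarr b))
      (\<lambda>\<omega>. D \<omega> + reals \<sigma> ''sg'' 0 * reals \<sigma> w (nats \<sigma> ''s'' 0)
          * (\<Prod>i<n. marg (reals \<sigma> p (nats \<sigma> ''b'' 0 + i)) (\<omega> i)))"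
    by (rule expands_step[OF E p v_def]) (use 2(3,4) 3(3) in \<open>simp_all add: A3\<close>)
  \<comment> \<open>Since \<open>n\<close> and \<open>N\<close> are positive, all lower-order terms
    are absorbed into multiples of \<open>N * n\<close>. The summand 100 below covers the four
    closing assignments.\<close>
  have "n \<le> N * n" "N \<le> N * n" "1 \<le> N * n"
    using pos by simp_all
  with 1(4) 2(5) 3(4) have "t1 + t2 + t3 + 100 \<le> 700 * (N * n)"
    by linarith
  moreover have "N * n + N * n + N * n = 3 * N * n"
    by simp
  ultimately show ?thesis
    using E3 unfolding component_com_def
    by (simp add: wp_exec[OF 1(1)] wp_exec[OF 2(1)] wp_exec[OF 3(1)]
        table_def agree_def A3 n N L)
qed

section \<open>Adding all components of a mixture\<close>

definition mixture_com :: "vname \<Rightarrow> vname \<Rightarrow> vname \<Rightarrow> com" where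
  "mixture_com k w p = block
    [nlet ''s'' (NConst 0),
     nlet ''b'' (NConst 0),
     While (NLess (nv ''s'') (nv k)) (component_com w p)]"

text \<open>Iteration \<open>j\<close> costs a constant times the current table size
  \<open>N * 3 ^ j * n\<close>. These costs form a geometric series dominated by its last term, so
  the time bound has no factor \<open>K\<close>.\<close>

lemma mixture_com:
  assumes T: "table n N D \<sigma>" and pos: "n \<ge> 1" "N \<ge> 1"
    and names: "w \<notin> table_vars" "p \<notin> table_vars" and k: "k \<notin> index_vars" "nats \<sigma> k 0 = K"
    and p: "\<And>s i. s < K \<Longrightarrow> i < n \<Longrightarrow> reals \<sigma> p (s * n + i) \<in> {0, 1/2, 1}"
  shows "wp (mixture_com k w p) (\<lambda>t \<tau>. agree index_vars table_vars \<sigma> \<tau>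
      \<and> table n (N * 3 ^ K) (\<lambda>\<omega>. D \<omega> + reals \<sigma> ''sg'' 0 *
          (\<Sum>s<K. reals \<sigma> w s * (\<Prod>i<n. marg (reals \<sigma> p (s * n + i)) (\<omega> i)))) \<tau>
      \<and> t \<le> 800 * (N * 3 ^ K * n)) \<sigma>"
proof -
  define D' where "D' j = (\<lambda>\<omega>. D \<omega> + reals \<sigma> ''sg'' 0 *
    (\<Sum>s<j. reals \<sigma> w s * (\<Prod>i<n. marg (reals \<sigma> p (s * n + i)) (\<omega> i))))" for j
  \<comment> \<open>The bound triples in each iteration, which leaves room for the 700 units per
    entry of \<open>component_com\<close>. The reserve of 50 pays for the two initial assignments
    and the last test of the guard.\<close>
  define I where "I j t \<tau> \<longleftrightarrow> agree index_vars table_vars \<sigma> \<tau> \<and> table n (N * 3 ^ j) (D' j) \<tau>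
    \<and> nats \<tau> ''s'' 0 = j \<and> nats \<tau> ''b'' 0 = j * n \<and> t + 50 \<le> 800 * (N * 3 ^ j * n)" for j t \<tau>
  have "1 \<le> N * n"
    using pos by simp
  show ?thesis
    unfolding mixture_com_def
    apply simp
  proof (rule wp_While[where N = K and I = I])
    show "I 0 0 (nset ''b'' 0 0 (nset ''s'' 0 0 \<sigma>))"
      using T \<open>1 \<le> N * n\<close> by (simp add: I_def D'_def table_def agree_def)
  next
    fix j t \<tau> assume j: "j < K" and "I j t \<tau>"
    then have A: "\<And>x. x \<notin> index_vars \<Longrightarrow> nats \<tau> x = nats \<sigma> x"
        "\<And>x. x \<notin> table_vars \<Longrightarrow> reals \<tau> x = reals \<sigma> x"
      and T': "table n (N * 3 ^ j) (D' j) \<tau>" and s: "nats \<tau> ''s'' 0 = j" "nats \<tau> ''b'' 0 = j * n"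
      and t: "t + 50 \<le> 800 * (N * 3 ^ j * n)"
      by (auto simp: I_def agree_def)
    have pj: "reals \<tau> p (nats \<tau> ''b'' 0 + i) \<in> {0, 1/2, 1}" if "i < n" for i
      using p[OF j that] A(2)[OF names(2)] s by simp
    have D'_Suc: "(\<lambda>\<omega>. D' j \<omega> + reals \<tau> ''sg'' 0 * reals \<tau> w (nats \<tau> ''s'' 0)
        * (\<Prod>i<n. marg (reals \<tau> p (nats \<tau> ''b'' 0 + i)) (\<omega> i))) = D' (Suc j)"
      using A(2)[OF names(1)] A(2)[OF names(2)] A(2)[of "''sg''"] s
      by (simp add: D'_def algebra_simps)
    have "1 \<le> N * 3 ^ j * n"
      using pos by simp
    have "wp (component_com w p) (\<lambda>u. I (Suc j) (bcost (NLess (nv ''s'') (nv k)) + t + u + 1)) \<tau>"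
    proof (rule wp_mono[OF component_com[OF T' pos(1) _ names pj]])
      show "1 \<le> N * 3 ^ j"
        using pos by simp
    next
      fix u \<rho>
      assume "agree index_vars table_vars \<tau> \<rho>
        \<and> table n (3 * (N * 3 ^ j)) (\<lambda>\<omega>. D' j \<omega> + reals \<tau> ''sg'' 0 * reals \<tau> w (nats \<tau> ''s'' 0)
            * (\<Prod>i<n. marg (reals \<tau> p (nats \<tau> ''b'' 0 + i)) (\<omega> i))) \<rho>
        \<and> nats \<rho> ''s'' 0 = Suc (nats \<tau> ''s'' 0) \<and> nats \<rho> ''b'' 0 = nats \<tau> ''b'' 0 + n
        \<and> u \<le> 700 * (N * 3 ^ j * n)"
      with \<open>I j t \<tau>\<close> t \<open>1 \<le> N * 3 ^ j * n\<close>
      show "I (Suc j) (bcost (NLess (nv ''s'') (nv k)) + t + u + 1) \<rho>"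
        unfolding I_def D'_Suc by (auto simp: s algebra_simps intro: agree_trans)
    qed
    with j s A(1)[OF k(1)] k(2)
    show "bval (NLess (nv ''s'') (nv k)) \<tau>
      \<and> wp (component_com w p) (\<lambda>u. I (Suc j) (bcost (NLess (nv ''s'') (nv k)) + t + u + 1)) \<tau>"
      by simp
  qed (use k in \<open>simp add: I_def D'_def agree_def\<close>)
qed

section \<open>Initial table and final summation\<close>

text \<open>The table of the zero function has one row, the pair of empty sets: sign 1, value 0,
  support the whole cube. The value is not written, since memory is initially 0.\<close>

definition start_com :: com where
  "start_com = block
    [nlet ''N'' (NConst 1),
     nlet ''L'' (nv ''n''),
     rlet ''g'' (RConst 1),
     nlet ''i'' (NConst 0),
     While (NLess (nv ''i'') (nv ''n'')) (block
       [RSet ''Z0'' (nv ''i'') (RConst 1),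
        RSet ''Z1'' (nv ''i'') (RConst 1),
        incr ''i''])]"

lemma start_com:
  assumes "nats \<sigma> ''n'' 0 = n" "reals \<sigma> ''W'' 0 = 0"
  shows "wp start_com (\<lambda>t \<tau>. agree index_vars table_vars \<sigma> \<tau> \<and> table n 1 (\<lambda>_. 0) \<tau>
      \<and> t \<le> 50 * n + 50) \<sigma>"
  unfolding start_com_def
  apply simp
  apply (rule wp_While[where N = n and
     I = "\<lambda>j t \<tau>. agree {''i'', ''N'', ''L''} {''g'', ''Z0'', ''Z1''} \<sigma> \<tau> \<and> nats \<tau> ''i'' 0 = j
       \<and> nats \<tau> ''N'' 0 = 1 \<and> nats \<tau> ''L'' 0 = n \<and> reals \<tau> ''g'' 0 = 1
       \<and> (\<forall>i<j. reals \<tau> ''Z0'' i = 1 \<and> reals \<tau> ''Z1'' i = 1) \<and> t \<le> 50 * j"])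
  subgoal
    using assms by (simp add: agree_def)
  subgoal
    using assms by (simp add: agree_def less_Suc_eq)
  subgoal
    unfolding table_def using assms
    by (intro conjI expands_init) (simp_all add: agree_def)
  done

text \<open>The branch computes an absolute value. The index \<open>a\<close> is never reset between
  rows, so it stands at \<open>m * n\<close> when row \<open>m\<close> begins.\<close>

definition term_com :: com where
  "term_com = block
    [rlet ''c'' (RGet ''g'' (nv ''m'')),
     Branch (RLess (RGet ''W'' (nv ''m'')) (RConst 0))
       (rlet ''c'' (RMul (rv ''c'') (RSub (RConst 0) (RGet ''W'' (nv ''m'')))))
       (rlet ''c'' (RMul (rv ''c'') (RGet ''W'' (nv ''m'')))),
     nlet ''i'' (NConst 0),
     While (NLess (nv ''i'') (nv ''n'')) (block
       [rlet ''c'' (RMul (rv ''c'')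
          (RAdd (RGet ''Z0'' (nv ''a'')) (RGet ''Z1'' (nv ''a'')))),
        incr ''a'',
        incr ''i''])]"

lemma term_com:
  assumes "nats \<sigma> ''n'' 0 = n"
  shows "wp term_com (\<lambda>t \<tau>. agree {''i'', ''a''} {''c''} \<sigma> \<tau>
      \<and> nats \<tau> ''a'' 0 = nats \<sigma> ''a'' 0 + n
      \<and> reals \<tau> ''c'' 0 = reals \<sigma> ''g'' (nats \<sigma> ''m'' 0) * \<bar>reals \<sigma> ''W'' (nats \<sigma> ''m'' 0)\<bar>
          * (\<Prod>i<n. reals \<sigma> ''Z0'' (nats \<sigma> ''a'' 0 + i) + reals \<sigma> ''Z1'' (nats \<sigma> ''a'' 0 + i))
      \<and> t \<le> 50 * n + 50) \<sigma>"
proof -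
  \<comment> \<open>The loop is treated from an arbitrary start state \<rho>, so that it serves
    after both outcomes of the branch.\<close>
  have "wp (While (NLess (nv ''i'') (nv ''n'')) (block
       [rlet ''c'' (RMul (rv ''c'')
          (RAdd (RGet ''Z0'' (nv ''a'')) (RGet ''Z1'' (nv ''a'')))),
        incr ''a'',
        incr ''i''])) (\<lambda>t \<tau>. agree {''i'', ''a''} {''c''} \<sigma> \<tau>
      \<and> nats \<tau> ''a'' 0 = nats \<sigma> ''a'' 0 + n
      \<and> reals \<tau> ''c'' 0 = reals \<rho> ''c'' 0
          * (\<Prod>i<n. reals \<sigma> ''Z0'' (nats \<sigma> ''a'' 0 + i) + reals \<sigma> ''Z1'' (nats \<sigma> ''a'' 0 + i))
      \<and> t \<le> 50 * n + 10) \<rho>"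
    if "agree {''i''} {''c''} \<sigma> \<rho>" "nats \<rho> ''i'' 0 = 0" for \<rho>
    apply (rule wp_While[where N = n and
       I = "\<lambda>j t \<tau>. agree {''i'', ''a''} {''c''} \<sigma> \<tau> \<and> nats \<tau> ''i'' 0 = j
         \<and> nats \<tau> ''a'' 0 = nats \<sigma> ''a'' 0 + j
         \<and> reals \<tau> ''c'' 0 = reals \<rho> ''c'' 0
          * (\<Prod>i<j. reals \<sigma> ''Z0'' (nats \<sigma> ''a'' 0 + i) + reals \<sigma> ''Z1'' (nats \<sigma> ''a'' 0 + i))
         \<and> t \<le> 50 * j"])
    using assms that by (simp_all add: agree_def)
  note loop = this[simplified]
  show ?thesis
    unfolding term_com_def
    by (cases "reals \<sigma> ''W'' (nats \<sigma> ''m'' 0) < 0"; simp; rule wp_mono[OF loop])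
       (simp_all add: agree_def)
qed

definition sum_com :: com where
  "sum_com = block
    [nlet ''m'' (NConst 0),
     nlet ''a'' (NConst 0),
     While (NLess (nv ''m'') (nv ''N'')) (block
       [term_com,
        rlet ''out'' (RAdd (rv ''out'') (rv ''c'')),
        incr ''m'']),
     rlet ''out'' (RDiv (rv ''out'') (RConst 2))]"

lemma sum_com:
  assumes T: "table n N D \<sigma>" and out: "reals \<sigma> ''out'' 0 = 0" and pos: "n \<ge> 1" "N \<ge> 1"
  shows "wp sum_com (\<lambda>t \<tau>. reals \<tau> ''out'' 0 = (\<Sum>\<omega>\<in>cube n. \<bar>D \<omega>\<bar>) / 2
      \<and> t \<le> 250 * (N * n)) \<sigma>"
proof -
  have n: "nats \<sigma> ''n'' 0 = n" and N: "nats \<sigma> ''N'' 0 = N"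
    and E: "expands n N (reals \<sigma> ''g'') (reals \<sigma> ''W'') (\<lambda>b. reals \<sigma> (Zarr b)) D"
    using T by (simp_all add: table_def)
  have "1 \<le> N * n"
    using pos by simp
  define f where "f m = reals \<sigma> ''g'' m * \<bar>reals \<sigma> ''W'' m\<bar>
    * (\<Prod>i<n. reals \<sigma> ''Z0'' (m * n + i) + reals \<sigma> ''Z1'' (m * n + i))" for m
  \<comment> \<open>The term \<open>50 * (N * n)\<close> makes the reserve of 50 available from the
    start; it pays for the assignments outside the loop and the last test of the guard.\<close>
  define I where "I j t \<tau> \<longleftrightarrow> agree {''i'', ''a'', ''m''} {''c'', ''out''} \<sigma> \<tau>
    \<and> nats \<tau> ''m'' 0 = j \<and> nats \<tau> ''a'' 0 = j * n \<and> reals \<tau> ''out'' 0 = (\<Sum>m<j. f m)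
    \<and> t + 50 \<le> 150 * (j * n) + 50 * (N * n)" for j t \<tau>
  have sum_f: "(\<Sum>m<N. f m) = (\<Sum>\<omega>\<in>cube n. \<bar>D \<omega>\<bar>)"
    using expands_sum_abs[OF E] by (simp add: f_def)
  show ?thesis
    unfolding sum_com_def
    apply simp
  proof (rule wp_While[where N = N and I = I], goal_cases)
    case 1
    show ?case
      using out \<open>1 \<le> N * n\<close> by (simp add: I_def agree_def)
  next
    case (2 j t \<tau>)
    then have A: "\<And>x. x \<notin> {''i'', ''a'', ''m''} \<Longrightarrow> nats \<tau> x = nats \<sigma> x"
        "\<And>x. x \<notin> {''c'', ''out''} \<Longrightarrow> reals \<tau> x = reals \<sigma> x"
      and m: "nats \<tau> ''m'' 0 = j" "nats \<tau> ''a'' 0 = j * n"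
      by (auto simp: I_def agree_def)
    from term_com[of \<tau> n] obtain u \<rho> where
      u: "exec term_com \<tau> u \<rho>" "agree {''i'', ''a''} {''c''} \<tau> \<rho>" "nats \<rho> ''a'' 0 = j * n + n"
        "reals \<rho> ''c'' 0 = f j" "u \<le> 50 * n + 50"
      unfolding wp_def by (auto simp: A n m f_def)
    show ?case
      using 2 u(2-) pos by (simp add: wp_exec[OF u(1)]) (simp add: I_def agree_def N)
  qed (use N in \<open>simp add: I_def agree_def sum_f\<close>)
qed

section \<open>The complete program and its running time\<close>

definition tv_com :: com where
  "tv_com = block
    [start_com,
     rlet ''sg'' (RConst 1),
     mixture_com ''k1'' ''alpha'' ''P'',
     rlet ''sg'' (RSub (RConst 0) (RConst 1)),
     mixture_com ''k2'' ''beta'' ''Q'',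
     sum_com]"

lemma marginal_table:
  assumes "s < ncomp P" "i < n"
  shows "marginal_table n P (s * n + i) = pmf (marginal P s i) True"
proof -
  have "s * n + i < Suc s * n"
    using assms by simp
  also have "\<dots> \<le> ncomp P * n"
    using assms by (intro mult_right_mono) auto
  finally show ?thesis
    using assms by (simp add: marginal_table_def)
qed

text \<open>The input stores only the probability of \<open>True\<close>; \<open>marg\<close>
  recovers that of \<open>False\<close> as its complement to 1.\<close>

lemma mixture_prob_eq_tables:
  "mixture_prob n P \<omega> = (\<Sum>s<ncomp P. weight_table P s
    * (\<Prod>i<n. marg (marginal_table n P (s * n + i)) (\<omega> i)))"
proof -
  have "marg (pmf q True) b = pmf q b" for q b
    by (cases b) (simp_all add: marg_def pmf_False_conv_True)
  then show ?thesis
    unfolding mixture_prob_def by (simp add: weight_table_def marginal_table)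
qed

text \<open>The table represents in turn 0, the mixture \<open>P\<close> (added with sign 1) and the
  difference of \<open>P\<close> and \<open>Q\<close> (\<open>Q\<close> added with sign -1). The
  final summation then yields half the sum of absolute values.\<close>

lemma tv_com:
  assumes n: "n \<ge> 1" and P: "is_subcube_mixture n P" and Q: "is_subcube_mixture n Q"
  shows "wp tv_com (\<lambda>t \<sigma>. result \<sigma> = d_TV n P Q \<and> t \<le> 2000 * (3 ^ (ncomp P + ncomp Q) * n))
    (input_state n P Q)"
proof -
  define \<sigma>0 where "\<sigma>0 = input_state n P Q"
  have \<sigma>0: "nats \<sigma>0 ''n'' 0 = n" "nats \<sigma>0 ''k1'' 0 = ncomp P" "nats \<sigma>0 ''k2'' 0 = ncomp Q"
    "reals \<sigma>0 ''W'' 0 = 0" "reals \<sigma>0 ''out'' 0 = 0"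
    "reals \<sigma>0 ''alpha'' = weight_table P" "reals \<sigma>0 ''P'' = marginal_table n P"
    "reals \<sigma>0 ''beta'' = weight_table Q" "reals \<sigma>0 ''Q'' = marginal_table n Q"
    by (simp_all add: \<sigma>0_def input_state_def)
  have mP: "marginal_table n P (s * n + i) \<in> {0, 1/2, 1}" if "s < ncomp P" "i < n" for s i
    using P that by (simp only: marginal_table is_subcube_mixture_def)
  have mQ: "marginal_table n Q (s * n + i) \<in> {0, 1/2, 1}" if "s < ncomp Q" "i < n" for s i
    using Q that by (simp only: marginal_table is_subcube_mixture_def)
  from start_com[OF \<sigma>0(1,4)] obtain t1 \<sigma>1 where
    1: "exec start_com \<sigma>0 t1 \<sigma>1" "agree index_vars table_vars \<sigma>0 \<sigma>1" "table n 1 (\<lambda>_. 0) \<sigma>1"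
      "t1 \<le> 50 * n + 50"
    unfolding wp_def by blast
  define \<sigma>1' where "\<sigma>1' = rset ''sg'' 0 1 \<sigma>1"
  have "agree index_vars (insert ''sg'' table_vars) \<sigma>0 \<sigma>1'" "table n 1 (\<lambda>_. 0) \<sigma>1'"
    "reals \<sigma>1' ''sg'' 0 = 1"
    using 1(2,3) by (simp_all add: \<sigma>1'_def agree_def)
  note sg1 = this
  have A1: "\<And>x. x \<notin> index_vars \<Longrightarrow> nats \<sigma>1' x = nats \<sigma>0 x"
      "\<And>x. x \<notin> insert ''sg'' table_vars \<Longrightarrow> reals \<sigma>1' x = reals \<sigma>0 x"
    using sg1(1) by (auto simp: agree_def)
  have "wp (mixture_com ''k1'' ''alpha'' ''P'') (\<lambda>t \<tau>. agree index_vars table_vars \<sigma>1' \<tau>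
      \<and> table n (3 ^ ncomp P) (mixture_prob n P) \<tau> \<and> t \<le> 800 * (3 ^ ncomp P * n)) \<sigma>1'"
    by (rule wp_mono[OF mixture_com[OF sg1(2) n _ _ _ _ _, where K = "ncomp P"]])
       (use mP in \<open>simp_all add: A1 sg1(3) \<sigma>0 mixture_prob_eq_tables[abs_def]\<close>)
  then obtain t2 \<sigma>2 where
    2: "exec (mixture_com ''k1'' ''alpha'' ''P'') \<sigma>1' t2 \<sigma>2" "agree index_vars table_vars \<sigma>1' \<sigma>2"
      "table n (3 ^ ncomp P) (mixture_prob n P) \<sigma>2" "t2 \<le> 800 * (3 ^ ncomp P * n)"
    unfolding wp_def by blast
  define \<sigma>2' where "\<sigma>2' = rset ''sg'' 0 (- 1) \<sigma>2"
  have "agree index_vars (insert ''sg'' table_vars) \<sigma>0 \<sigma>2'"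
    "table n (3 ^ ncomp P) (mixture_prob n P) \<sigma>2'" "reals \<sigma>2' ''sg'' 0 = - 1"
    using 2(2,3) sg1(1) by (simp_all add: \<sigma>2'_def agree_def)
  note sg2 = this
  have A2: "\<And>x. x \<notin> index_vars \<Longrightarrow> nats \<sigma>2' x = nats \<sigma>0 x"
      "\<And>x. x \<notin> insert ''sg'' table_vars \<Longrightarrow> reals \<sigma>2' x = reals \<sigma>0 x"
    using sg2(1) by (auto simp: agree_def)
  let ?N = "3 ^ (ncomp P + ncomp Q) :: nat"
  have "wp (mixture_com ''k2'' ''beta'' ''Q'') (\<lambda>t \<tau>. agree index_vars table_vars \<sigma>2' \<tau>
      \<and> table n ?N (\<lambda>\<omega>. mixture_prob n P \<omega> - mixture_prob n Q \<omega>) \<tau> \<and> t \<le> 800 * (?N * n)) \<sigma>2'"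
    by (rule wp_mono[OF mixture_com[OF sg2(2) n _ _ _ _ _, where K = "ncomp Q"]])
       (use mQ in \<open>simp_all add: A2 sg2(3) \<sigma>0 mixture_prob_eq_tables[of n Q] power_add\<close>)
  then obtain t3 \<sigma>3 where
    3: "exec (mixture_com ''k2'' ''beta'' ''Q'') \<sigma>2' t3 \<sigma>3" "agree index_vars table_vars \<sigma>2' \<sigma>3"
      "table n ?N (\<lambda>\<omega>. mixture_prob n P \<omega> - mixture_prob n Q \<omega>) \<sigma>3" "t3 \<le> 800 * (?N * n)"
    unfolding wp_def by blast
  have "reals \<sigma>3 ''out'' 0 = 0"
    using 3(2) A2(2)[of "''out''"] \<sigma>0(5) by (simp add: agree_def)
  from sum_com[OF 3(3) this n] obtain t4 \<sigma>4 where
    4: "exec sum_com \<sigma>3 t4 \<sigma>4" "result \<sigma>4 = d_TV n P Q" "t4 \<le> 250 * (?N * n)"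
    unfolding wp_def d_TV_def result_def by (simp, blast)
  have "3 ^ ncomp P * n \<le> ?N * n" "1 * n \<le> ?N * n"
    by (intro mult_right_mono; simp add: power_add)+
  \<comment> \<open>The constant is 50 + 50 for the start, 800 for each mixture, 250 for the
    summation and 50 for the two assignments to \<open>sg\<close>.\<close>
  with 1(4) 2(4) 3(4) 4(3) n have "t1 + t2 + t3 + t4 + 50 \<le> 2000 * (?N * n)"
    by linarith
  with 4(2) show ?thesis
    unfolding tv_com_def \<sigma>0_def[symmetric]
    by (simp add: wp_exec[OF 1(1)] wp_exec[OF 2(1)] wp_exec[OF 3(1)] wp_exec[OF 4(1)]
        flip: \<sigma>1'_def \<sigma>2'_def)
qed

lemma ncomp_pos:
  assumes "is_mixture P"
  shows "ncomp P > 0"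
  using assms by (cases "ncomp P") (simp_all add: is_mixture_def)

theorem theorem1p2:
  "\<exists>(prog :: com) (C :: real). \<forall>(n :: nat) (P :: mixture) (Q :: mixture).
     n \<ge> 1 \<and> is_subcube_mixture n P \<and> is_subcube_mixture n Q \<longrightarrow>
     (\<exists>t \<sigma>. exec prog (input_state n P Q) t \<sigma> \<and>
        result \<sigma> = d_TV n P Q \<and>
        real t \<le> C * (real (ncomp P + ncomp Q) * 3 ^ (ncomp P + ncomp Q) * real n))"
proof (rule exI[of _ tv_com], rule exI[of _ 2000], intro allI impI)
  fix n P Q
  assume "n \<ge> 1 \<and> is_subcube_mixture n P \<and> is_subcube_mixture n Q"
  then have n: "n \<ge> 1" and P: "is_subcube_mixture n P" and Q: "is_subcube_mixture n Q"
    by simp_all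
  let ?k = "ncomp P + ncomp Q"
  from tv_com[OF n P Q] obtain t \<sigma> where t: "exec tv_com (input_state n P Q) t \<sigma>"
    "result \<sigma> = d_TV n P Q" "t \<le> 2000 * (3 ^ ?k * n)"
    unfolding wp_def by blast
  \<comment> \<open>Weights summing to 1 force at least one component, so the factor
    \<open>?k\<close> can be inserted into the bound of \<open>tv_com\<close>.\<close>
  have "1 \<le> ?k"
    using ncomp_pos[of P] P by (simp add: is_subcube_mixture_def)
  then have "1 * (3 ^ ?k * n) \<le> ?k * (3 ^ ?k * n)"
    by (rule mult_right_mono) simp
  with t(3) have "t \<le> 2000 * (?k * 3 ^ ?k * n)"
    unfolding mult_1 mult.assoc by linarith
  then have "real t \<le> real (2000 * (?k * 3 ^ ?k * n))"
    by (rule of_nat_mono)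
  then have "real t \<le> 2000 * (real ?k * 3 ^ ?k * real n)"
    by simp
  with t(1,2) show "\<exists>t \<sigma>. exec tv_com (input_state n P Q) t \<sigma> \<and> result \<sigma> = d_TV n P Q \<and>
      real t \<le> 2000 * (real ?k * 3 ^ ?k * real n)"
    by blast
qed

end
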